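(* Let $k$ be a field, let $\Delta$ be a simplicial complex of dimension $d-1$ with $f$-vector $f(\Delta) = (f_{-1},\ldots,f_{d-1})$, and let $r \geq 1$ be an integer. If $\Delta^{\langle r \rangle}$ is a simplicial complex such that $\mathrm{Hilb}(k[\Delta]^{\langle r\rangle},t) = \mathrm{Hilb}(k[\Delta^{\langle r\rangle}],t)$, then its $f$-vector $f(\Delta^{\langle r\rangle}) = (f_{-1}^{\langle r\rangle},\ldots,f_{d-1}^{\langle r\rangle})$ satisfies $$f_{i-1}^{\langle r \rangle} = \sum_{\ell = i}^d \ \sum_{\substack{j_1 + \cdots + j_i = \ell \\ j_1,\ldots,j_i \geq 1}} \binom{r-1}{j_1-1}\binom{r}{j_2}\cdots\binom{r}{j_i}\, f_{\ell-1}$$ for $0 \leq i \leq d$, where for $i=0$ the inner sum is over the empty tuple, which contributes only for $\ell=0$ with (empty) product $1$, so that the formula reads $f_{-1}^{\langle r\rangle} = f_{-1}$.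
   Context: Simplicial complexes are finite and contain the empty face. For a simplicial complex $\Delta$ over a finite ground set $\Omega$ and a field $k$, the Stanley–Reisner ring is $k[\Delta] = k[x_\omega : \omega\in\Omega]/I_\Delta$, where $I_\Delta$ is the ideal generated by the monomials $\prod_{\omega\in B} x_\omega$ for $B\subseteq \Omega$, $B\notin\Delta$; it is a standard graded $k$-algebra. The $f$-vector of a $(d-1)$-dimensional complex is $(f_{-1},\ldots,f_{d-1})$, where $f_i$ is the number of $i$-dimensional faces (faces with $i+1$ elements), so $f_{-1}=1$. For a graded $k$-algebra $A=\bigoplus_{n\ge0}A_n$, $\mathrm{Hilb}(A,t)=\sum_{n\ge 0}\dim_k A_n\, t^n$, and the $r$th Veronese algebra is $A^{\langle r\rangle} = \bigoplus_{n\ge 0} A_{nr}$, with $A_{nr}$ placed in degree $n$. *)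

theory Defs
  imports
    "HOL-Algebra.Embedded_Algebras"
    "HOL-Algebra.QuotRing"
    "HOL-Library.Poly_Mapping"
    "HOL-Computational_Algebra.Formal_Power_Series"
begin

section \<open>Simplicial complexes\<close>

definition simplicial_complex :: "'v set \<Rightarrow> 'v set set \<Rightarrow> bool" where
  "simplicial_complex \<Omega> \<Delta> \<longleftrightarrow>
     finite \<Omega> \<and> \<Delta> \<subseteq> Pow \<Omega> \<and> {} \<in> \<Delta> \<and> (\<forall>F\<in>\<Delta>. \<forall>G. G \<subseteq> F \<longrightarrow> G \<in> \<Delta>)"

definition face_dim :: "'v set \<Rightarrow> int" where
  "face_dim F = int (card F) - 1"

definition complex_dim :: "'v set set \<Rightarrow> int" where
  "complex_dim \<Delta> = Max (face_dim ` \<Delta>)"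

text \<open>The entry \<open>f\<^sub>i\<close> of the f-vector; the index is an integer because it starts at \<open>-1\<close>.\<close>

definition f_entry :: "'v set set \<Rightarrow> int \<Rightarrow> nat" where
  "f_entry \<Delta> i = card {F \<in> \<Delta>. face_dim F = i}"


section \<open>Graded algebras over a field\<close>

text \<open>
  An algebra over a field is represented as a ring containing the field, as in
  \<^theory>\<open>HOL-Algebra.Embedded_Algebras\<close>: \<open>base_field A\<close> is the copy of the field inside
  the ring \<open>A\<close>, and \<open>component A n\<close> is the homogeneous part of degree \<open>n\<close>.
\<close>

record 'a graded_algebra = "'a ring" +
  base_field :: "'a set"
  component :: "nat \<Rightarrow> 'a set"

definition hilbert_series :: "'a graded_algebra \<Rightarrow> int fps" where
  "hilbert_series A = Abs_fps (\<lambda>n. int (ring.dim A (base_field A) (component A n)))"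

text \<open>
  The carrier is the additive subgroup generated by the selected components, i.e.\ their
  (internal direct) sum.
\<close>

definition veronese :: "nat \<Rightarrow> 'a graded_algebra \<Rightarrow> 'a graded_algebra" where
  "veronese r A = A\<lparr>
     carrier := generate (add_monoid A) (\<Union>n. component A (n * r)),
     component := (\<lambda>n. component A (n * r))\<rparr>"


section \<open>Polynomial rings and Stanley--Reisner rings\<close>

text \<open>
  A polynomial maps exponent vectors (finitely supported functions from variables to naturals)
  to coefficients, with finite support; multiplication on this type is convolution.
\<close>

type_synonym ('v, 'k) mpoly = "('v \<Rightarrow>\<^sub>0 nat) \<Rightarrow>\<^sub>0 'k"

definition mvar :: "'v \<Rightarrow> ('v, 'k::field) mpoly" where
  "mvar v = Poly_Mapping.single (Poly_Mapping.single v 1) 1"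

definition mconst :: "'k::field \<Rightarrow> ('v, 'k) mpoly" where
  "mconst c = Poly_Mapping.single 0 c"

definition exp_degree :: "('v \<Rightarrow>\<^sub>0 nat) \<Rightarrow> nat" where
  "exp_degree m = (\<Sum>v\<in>Poly_Mapping.keys m. Poly_Mapping.lookup m v)"

definition mpolys :: "'v set \<Rightarrow> ('v, 'k::field) mpoly set" where
  "mpolys \<Omega> = {p. \<forall>m\<in>Poly_Mapping.keys p. Poly_Mapping.keys m \<subseteq> \<Omega>}"

text \<open>
  The argument of type \<open>'k itself\<close> only selects the coefficient field, which is the whole
  type \<open>'k\<close>.
\<close>

definition mpoly_algebra :: "'k::field itself \<Rightarrow> 'v set \<Rightarrow> ('v, 'k) mpoly graded_algebra" where
  "mpoly_algebra k \<Omega> = \<lparr>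
     carrier = mpolys \<Omega>, monoid.mult = (*), one = 1, zero = 0, add = (+),
     base_field = range mconst,
     component = (\<lambda>n. {p \<in> mpolys \<Omega>. \<forall>m\<in>Poly_Mapping.keys p. exp_degree m = n})\<rparr>"

text \<open>
  The quotient of a graded algebra by a (homogeneous) ideal; the base field and the homogeneous
  components are the images under the canonical projection.
\<close>

definition quotient_algebra ::
    "'a graded_algebra \<Rightarrow> 'a set \<Rightarrow> 'a set graded_algebra" where
  "quotient_algebra A I = ring.extend (A Quot I)
     (graded_algebra.fields
        ((\<lambda>a. I +>\<^bsub>A\<^esub> a) ` base_field A)
        (\<lambda>n. (\<lambda>a. I +>\<^bsub>A\<^esub> a) ` component A n))"

definition stanley_reisner_ideal ::
    "'k::field itself \<Rightarrow> 'v set \<Rightarrow> 'v set set \<Rightarrow> ('v, 'k) mpoly set" where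
  "stanley_reisner_ideal k \<Omega> \<Delta> =
     Idl\<^bsub>mpoly_algebra k \<Omega>\<^esub> {\<Prod>\<omega>\<in>B. mvar \<omega> | B. B \<subseteq> \<Omega> \<and> B \<notin> \<Delta>}"

definition stanley_reisner_ring ::
    "'k::field itself \<Rightarrow> 'v set \<Rightarrow> 'v set set \<Rightarrow> ('v, 'k) mpoly set graded_algebra" where
  "stanley_reisner_ring k \<Omega> \<Delta> =
     quotient_algebra (mpoly_algebra k \<Omega>) (stanley_reisner_ideal k \<Omega> \<Delta>)"

end

theory Submission
  imports Defs
begin

text \<open>
  Modulo the Stanley--Reisner ideal, the monomials whose support is a face form a basis of
  \<open>k[\<Delta>]\<close>. Once \<open>F\<close> is ordered, a monomial of degree \<open>n\<close> with support \<open>F\<close> is a composition of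
  \<open>n\<close> into \<open>|F|\<close> positive parts. So, writing \<open>c(i, n)\<close> for the number of compositions of \<open>n\<close> into \<open>i\<close>
  positive parts, the degree-\<open>n\<close> coefficient of the Hilbert series of \<open>k[\<Delta>]\<close> is the sum of
  \<open>c(|F|, n)\<close> over all faces \<open>F\<close> (\<open>hilbert_series_stanley_reisner_nth\<close>). Passing to the
  \<open>r\<close>th Veronese algebra only selects the coefficients at multiples of \<open>r\<close>
  (\<open>hilbert_series_veronese_nth\<close>). The hypothesis thus says that for all \<open>n\<close> the sum of
  \<open>c(|F'|, n)\<close> over the faces of \<open>\<Delta>'\<close> equals the sum of \<open>c(|F|, n r)\<close> over the faces of \<open>\<Delta>\<close>.

  The numbers \<open>c(l, n r)\<close> are combinations of the \<open>c(i, n)\<close> with coefficients independent of \<open>n\<close>,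
  and these coefficients are the inner sums \<open>N(i, l)\<close> of the claimed formula
  (\<open>card_compositions_mult\<close>). Indeed, for \<open>i \<ge> 1\<close>, \<open>N(i, l)\<close> is the coefficient of \<open>x^l\<close> in
  \<open>x (1 + x)^(r - 1) ((1 + x)^r - 1)^(i - 1)\<close>, while \<open>c(i, n) = (n - 1) choose (i - 1)\<close>
  for \<open>n \<ge> 1\<close>; the binomial theorem collapses the sum over \<open>i\<close> to \<open>x (1 + x)^(n r - 1)\<close>.

  Finally \<open>c(i, n) = 0\<close> for \<open>i > n\<close> and \<open>c(n, n) = 1\<close>, so the functions \<open>c(i, _)\<close> are linearly
  independent in a triangular way (\<open>triangular_unique\<close>), and comparing coefficients yields
  the number of faces of \<open>\<Delta>'\<close> with \<open>i\<close> elements as the sum of \<open>N(i, |F|)\<close> over \<open>F \<in> \<Delta>\<close>. The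
  dimension of \<open>\<Delta>'\<close> can be read off from \<open>N(i, l) = 0\<close> for \<open>i > l\<close> and \<open>N(d, d) > 0\<close>.
\<close>

unbundle fps_syntax

section \<open>Compositions of integers and the Veronese transformation\<close>

definition compositions :: "nat \<Rightarrow> nat \<Rightarrow> nat list set" where
  "compositions i n = {js. length js = i \<and> sum_list js = n \<and> (\<forall>j\<in>set js. j \<ge> 1)}"

lemma finite_compositions: "finite (compositions i n)"
proof (rule finite_subset)
  show "compositions i n \<subseteq> {js. set js \<subseteq> {..n} \<and> length js = i}"
    by (auto simp: compositions_def intro: member_le_sum_list)
qed (simp add: finite_lists_length_eq)

lemma compositions_0: "compositions 0 n = (if n = 0 then {[]} else {})"
  by (auto simp: compositions_def)

lemma length_le_sum_list_pos: "\<forall>j\<in>set js. (1::nat) \<le> j \<Longrightarrow> length js \<le> sum_list js"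
  by (induction js) auto

lemma compositions_empty: "n < i \<Longrightarrow> compositions i n = {}"
  using length_le_sum_list_pos by (fastforce simp: compositions_def)

text \<open>
  Splitting off the first part is the recursion behind both generating functions below.
\<close>

lemma sum_compositions_Suc:
  "(\<Sum>js\<in>compositions (Suc i) n. g js) = (\<Sum>j=1..n. \<Sum>js\<in>compositions i (n - j). g (j # js))"
proof -
  let ?S = "SIGMA j:{1..n}. compositions i (n - j)"
  have eq: "compositions (Suc i) n = (\<lambda>(j, js). j # js) ` ?S"
  proof (intro equalityI subsetI)
    fix js assume js: "js \<in> compositions (Suc i) n"
    then obtain j js' where [simp]: "js = j # js'"
      by (cases js) (auto simp: compositions_def)
    from js have "(j, js') \<in> ?S" by (auto simp: compositions_def)
    then have "(case (j, js') of (j, js) \<Rightarrow> j # js) \<in> (\<lambda>(j, js). j # js) ` ?S" by (rule imageI)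
    then show "js \<in> (\<lambda>(j, js). j # js) ` ?S" by simp
  qed (auto simp: compositions_def)
  have "inj_on (\<lambda>(j, js). j # js) ?S" by (auto simp: inj_on_def)
  then have "sum g (compositions (Suc i) n) = (\<Sum>(j, js)\<in>?S. g (j # js))"
    unfolding eq by (subst sum.reindex) (auto simp: case_prod_beta o_def)
  also have "\<dots> = (\<Sum>j=1..n. \<Sum>js\<in>compositions i (n - j). g (j # js))"
    by (rule sum.Sigma[symmetric]) (auto simp: finite_compositions)
  finally show ?thesis .
qed

text \<open>
  The parts of a composition are chosen independently, so the weights multiply as power series;
  positivity of the parts means that the constant term of the series is dropped.
\<close>

lemma sum_prod_compositions:
  fixes a :: "nat \<Rightarrow> 'a::comm_ring_1"
  shows "(\<Sum>js\<in>compositions i n. \<Prod>j\<leftarrow>js. a j) = fps_nth (Abs_fps (\<lambda>j. if j = 0 then 0 else a j) ^ i) n"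
proof (induction i arbitrary: n)
  case 0
  show ?case by (simp add: compositions_0)
next
  case (Suc i)
  let ?A = "Abs_fps (\<lambda>j. if j = 0 then 0 else a j)"
  have "(\<Sum>js\<in>compositions (Suc i) n. \<Prod>j\<leftarrow>js. a j)
      = (\<Sum>j=1..n. a j * (?A ^ i) $ (n - j))"
    by (simp add: sum_compositions_Suc sum_distrib_left[symmetric] Suc.IH)
  also have "\<dots> = (\<Sum>j=0..n. ?A $ j * (?A ^ i) $ (n - j))"
    by (rule sum.mono_neutral_cong_left) auto
  finally show ?case by (simp add: fps_mult_nth)
qed

text \<open>
  Subtracting 1 from every part leaves nonnegative parts, which stars and bars counts.
\<close>

lemma card_compositions:
  assumes "n \<ge> 1"
  shows "card (compositions (Suc i) n) = (n - 1) choose i"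
proof (cases "Suc i \<le> n")
  case True
  let ?W = "{js. length js = Suc i \<and> sum_list js = n - Suc i}"
  have "compositions (Suc i) n = map Suc ` ?W"
  proof (intro equalityI subsetI)
    fix js assume js: "js \<in> compositions (Suc i) n"
    define ks where "ks = map (\<lambda>j. j - 1) js"
    have jk: "js = map Suc ks"
      unfolding ks_def using js by (auto simp: compositions_def intro!: map_idI[symmetric])
    with js have "ks \<in> ?W"
      using sum_list_Suc[of "\<lambda>x. x" ks] by (auto simp: compositions_def)
    with jk show "js \<in> map Suc ` ?W" by blast
  next
    fix js assume "js \<in> map Suc ` ?W"
    then show "js \<in> compositions (Suc i) n"
      using True sum_list_Suc[of "\<lambda>x. x"] by (auto simp: compositions_def)
  qed
  then have "card (compositions (Suc i) n) = card ?W"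
    by (simp add: card_image[OF inj_on_subset[OF inj_mapI[OF inj_Suc]]])
  also have "\<dots> = (n - 1) choose (n - Suc i)"
    using True by (simp add: card_length_sum_list)
  also have "\<dots> = (n - 1) choose i"
    using True binomial_symmetric[of i "n - 1"] by simp
  finally show ?thesis .
next
  case False
  then show ?thesis using assms by (simp add: compositions_empty)
qed

definition subdivision_weight :: "nat \<Rightarrow> nat list \<Rightarrow> nat" where
  "subdivision_weight r js = (case js of
      [] \<Rightarrow> 1
    | j # js' \<Rightarrow> ((r - 1) choose (j - 1)) * (\<Prod>j'\<leftarrow>js'. r choose j'))"

text \<open>
  The number \<open>N(i, l)\<close>: how many faces with \<open>i\<close> elements one face with \<open>l\<close> elements contributes
  to the Veronese complex.
\<close>

definition veronese_coeff :: "nat \<Rightarrow> nat \<Rightarrow> nat \<Rightarrow> nat" where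
  "veronese_coeff r i l = (\<Sum>js\<in>compositions i l. subdivision_weight r js)"

lemma veronese_coeff_empty: "l < i \<Longrightarrow> veronese_coeff r i l = 0"
  by (simp add: veronese_coeff_def compositions_empty)

lemma veronese_coeff_diag_pos:
  assumes "r \<ge> 1"
  shows "veronese_coeff r i i > 0"
proof -
  have "replicate i 1 \<in> compositions i i"
    by (auto simp: compositions_def sum_list_replicate)
  moreover have "subdivision_weight r (replicate i 1) > 0"
    using assms by (cases i) (simp_all add: subdivision_weight_def prod_list_replicate map_replicate)
  ultimately show ?thesis
    unfolding veronese_coeff_def
    by (intro sum_pos2[OF finite_compositions]) auto
qed

lemma of_nat_prod_list_map: "of_nat (\<Prod>j\<leftarrow>js. f j) = (\<Prod>j\<leftarrow>js. of_nat (f j) :: 'a::comm_semiring_1)"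
  by (induction js) auto

lemma fps_nth_one_plus_X_power: "fps_nth ((1 + fps_X :: int fps) ^ n) k = int (n choose k)"
proof (induction n arbitrary: k)
  case 0
  show ?case by (cases k) auto
next
  case (Suc n)
  show ?case by (cases k) (simp_all add: distrib_right Suc.IH)
qed

text \<open>
  The first part carries the weight \<open>(r - 1) choose (j - 1)\<close>, whose generating function is
  \<open>x (1 + x)^(r - 1)\<close>; each of the other parts contributes \<open>r choose j\<close> with \<open>j \<ge> 1\<close>, that is, the
  series \<open>(1 + x)^r - 1\<close>.
\<close>

lemma veronese_coeff_Suc:
  "int (veronese_coeff r (Suc i) l)
   = fps_nth (fps_X * (1 + fps_X) ^ (r - 1) * ((1 + fps_X) ^ r - 1) ^ i) l"
proof -
  have part: "Abs_fps (\<lambda>j. if j = 0 then 0 else int (r choose j)) = (1 + fps_X) ^ r - 1"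
    by (rule fps_ext) (simp add: fps_nth_one_plus_X_power)
  have "int (veronese_coeff r (Suc i) l)
      = (\<Sum>j=1..l. int ((r - 1) choose (j - 1)) *
          (\<Sum>js\<in>compositions i (l - j). \<Prod>j'\<leftarrow>js. int (r choose j')))"
    unfolding veronese_coeff_def sum_compositions_Suc
    by (simp add: subdivision_weight_def sum_distrib_left of_nat_prod_list_map)
  also have "\<dots> = (\<Sum>j=0..l. (fps_X * (1 + fps_X) ^ (r - 1)) $ j * (((1 + fps_X) ^ r - 1) ^ i) $ (l - j))"
    unfolding sum_prod_compositions part
    by (rule sum.mono_neutral_cong_left) (auto simp: fps_nth_one_plus_X_power)
  finally show ?thesis by (simp add: fps_mult_nth)
qed

text \<open>
  For \<open>n \<ge> 1\<close> and \<open>l \<ge> 1\<close>, both sides are the coefficient of \<open>x^l\<close> in \<open>x (1 + x)^(n r - 1)\<close>: on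
  the right, summing \<open>((1 + x)^r - 1)^(i - 1)\<close> against the binomial coefficients
  \<open>(n - 1) choose (i - 1)\<close> gives \<open>(1 + x)^(r (n - 1))\<close>. For \<open>n = 0\<close> both sides are 1 if
  \<open>l = 0\<close> and 0 otherwise; for \<open>l = 0 < n\<close> both vanish.
\<close>

lemma card_compositions_mult:
  assumes "r \<ge> 1"
  shows "card (compositions l (n * r)) = (\<Sum>i\<le>n. veronese_coeff r i l * card (compositions i n))"
proof (cases n)
  case 0
  then show ?thesis
    by (cases l) (simp_all add: compositions_0 veronese_coeff_def compositions_empty subdivision_weight_def)
next
  case (Suc m)
  show ?thesis
  proof (cases l)
    case 0
    have "veronese_coeff r i l * card (compositions i n) = 0" for i
      using 0 Suc by (cases i) (simp_all add: compositions_0 veronese_coeff_empty)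
    then show ?thesis using 0 Suc assms by (simp add: compositions_0)
  next
    case l: (Suc l')
    let ?b = "(1 + fps_X :: int fps) ^ r"
    have "int (\<Sum>i\<le>n. veronese_coeff r i l * card (compositions i n))
        = (\<Sum>i\<le>m. int (veronese_coeff r (Suc i) l) * int (m choose i))"
      unfolding Suc sum.atMost_Suc_shift by (simp add: compositions_0 card_compositions)
    also have "\<dots> = (fps_X * (1 + fps_X) ^ (r - 1) * (\<Sum>i\<le>m. of_nat (m choose i) * (?b - 1) ^ i)) $ l"
    proof -
      have "int (veronese_coeff r (Suc i) l) * int (m choose i)
          = (fps_X * (1 + fps_X) ^ (r - 1) * (of_nat (m choose i) * (?b - 1) ^ i)) $ l" for i
        unfolding veronese_coeff_Suc
        by (subst mult.left_commute, subst fps_mult_of_nat_nth(1), rule mult.commute)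
      then show ?thesis by (simp only: sum_distrib_left fps_sum_nth)
    qed
    also have "(\<Sum>i\<le>m. of_nat (m choose i) * (?b - 1) ^ i) = ?b ^ m"
      using binomial_ring[of "?b - 1" 1 m] by simp
    also have "fps_X * (1 + fps_X) ^ (r - 1) * ?b ^ m = fps_X * (1 + fps_X) ^ (n * r - 1)"
      using assms Suc by (simp add: power_mult[symmetric] power_add[symmetric] algebra_simps)
    also have "\<dots> $ l = int (card (compositions l (n * r)))"
      using assms Suc l by (simp add: fps_nth_one_plus_X_power card_compositions)
    finally show ?thesis by linarith
  qed
qed

text \<open>
  The matrix of composition numbers is unitriangular, since \<open>n\<close> has a single composition into
  \<open>n\<close> positive parts.
\<close>

lemma triangular_unique:
  fixes a b :: "nat \<Rightarrow> nat"
  assumes "\<And>n. (\<Sum>i\<le>n. a i * card (compositions i n)) = (\<Sum>i\<le>n. b i * card (compositions i n))"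
  shows "a n = b n"
proof (induction n rule: less_induct)
  case (less n)
  have "card (compositions n n) = 1"
    by (cases n) (simp_all add: compositions_0 card_compositions)
  moreover have "(\<Sum>i<n. a i * card (compositions i n)) = (\<Sum>i<n. b i * card (compositions i n))"
    by (intro sum.cong) (auto simp: less.IH)
  ultimately show ?case
    using assms[of n] by (simp add: lessThan_Suc_atMost[symmetric])
qed

section \<open>Counting monomials supported on faces\<close>

definition standard_exponents :: "'v set set \<Rightarrow> nat \<Rightarrow> ('v \<Rightarrow>\<^sub>0 nat) set" where
  "standard_exponents \<Delta> n = {m. Poly_Mapping.keys m \<in> \<Delta> \<and> exp_degree m = n}"

text \<open>
  Listing the support in a fixed order, the exponents of a monomial are the parts of a composition
  of its degree.
\<close>

lemma exponents_bij_compositions: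
  assumes "finite F"
  obtains h where "bij_betw h {m. Poly_Mapping.keys m = F \<and> exp_degree m = n} (compositions (card F) n)"
proof -
  obtain vs where vs: "set vs = F" "distinct vs"
    using finite_distinct_list[OF assms] by blast
  let ?E = "{m :: 'a \<Rightarrow>\<^sub>0 nat. Poly_Mapping.keys m = F \<and> exp_degree m = n}"
  let ?h = "\<lambda>m. map (Poly_Mapping.lookup m) vs"
  have "inj_on ?h ?E"
  proof (rule inj_onI)
    fix m m' assume m: "m \<in> ?E" "m' \<in> ?E" "?h m = ?h m'"
    show "m = m'"
    proof (rule poly_mapping_eqI)
      fix v show "Poly_Mapping.lookup m v = Poly_Mapping.lookup m' v"
      proof (cases "v \<in> F")
        case False
        then have "v \<notin> Poly_Mapping.keys m" "v \<notin> Poly_Mapping.keys m'" using m by auto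
        then show ?thesis by (simp add: in_keys_iff)
      next
        case True
        then show ?thesis using m(3) vs(1) by (simp add: map_eq_conv)
      qed
    qed
  qed
  moreover have "?h ` ?E = compositions (card F) n"
  proof (intro equalityI subsetI)
    fix js assume "js \<in> ?h ` ?E"
    then obtain m where m: "m \<in> ?E" "js = ?h m" by blast
    then have keys: "Poly_Mapping.keys m = F" and deg: "exp_degree m = n" by auto
    have "sum_list js = n"
      unfolding deg[symmetric] exp_degree_def keys m(2)
      using vs by (simp add: sum_list_distinct_conv_sum_set)
    moreover have "length js = card F"
      using distinct_card[OF vs(2)] vs(1) m(2) by simp
    moreover have "\<forall>j\<in>set js. j \<ge> 1"
    proof
      fix j assume "j \<in> set js"
      then obtain v where "v \<in> F" "j = Poly_Mapping.lookup m v" using m vs by auto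
      then show "j \<ge> 1" unfolding keys[symmetric] by (simp add: in_keys_iff)
    qed
    ultimately show "js \<in> compositions (card F) n" by (simp add: compositions_def)
  next
    fix js assume js: "js \<in> compositions (card F) n"
    then have len: "length js = length vs"
      using vs by (auto simp: compositions_def distinct_card)
    define f where "f v = (case map_of (zip vs js) v of None \<Rightarrow> 0 | Some j \<Rightarrow> j)" for v
    have fjs: "map f vs = js"
    proof (rule nth_equalityI)
      fix i assume "i < length (map f vs)"
      then show "map f vs ! i = js ! i"
        using len vs by (simp add: f_def map_of_zip_nth)
    qed (simp add: len)
    have f0: "f v = 0" if "v \<notin> F" for v
    proof -
      have "map_of (zip vs js) v = None" using that vs len by (simp add: map_of_zip_is_None)
      then show ?thesis by (simp add: f_def)
    qed
    have fpos: "f v \<noteq> 0" if "v \<in> F" for v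
    proof -
      have "f v \<in> set (map f vs)" using that vs(1) by simp
      then have "f v \<in> set js" by (simp only: fjs)
      then show ?thesis using js by (fastforce simp: compositions_def)
    qed
    have fin: "finite {v. f v \<noteq> 0}"
    proof (rule finite_subset[OF _ assms], rule subsetI, rule ccontr)
      fix v assume "v \<in> {v. f v \<noteq> 0}" "v \<notin> F"
      then show False using f0[of v] by simp
    qed
    define m where "m = Abs_poly_mapping f"
    have lm: "Poly_Mapping.lookup m = f" unfolding m_def by (rule lookup_Abs_poly_mapping[OF fin])
    have "v \<in> Poly_Mapping.keys m \<longleftrightarrow> v \<in> F" for v
      using f0[of v] fpos[of v] by (cases "v \<in> F") (simp_all add: in_keys_iff lm)
    then have km: "Poly_Mapping.keys m = F" by blast
    have "exp_degree m = sum_list (map f vs)"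
      unfolding exp_degree_def lm km using vs by (simp add: sum_list_distinct_conv_sum_set)
    then have "m \<in> ?E" using km fjs js by (simp add: compositions_def)
    moreover have "js = ?h m" using fjs by (simp add: lm)
    ultimately show "js \<in> ?h ` ?E" by blast
  qed
  ultimately have "bij_betw ?h ?E (compositions (card F) n)" by (simp add: bij_betw_def)
  then show ?thesis by (rule that)
qed

lemma card_standard_exponents:
  assumes "finite \<Delta>" "\<And>F. F \<in> \<Delta> \<Longrightarrow> finite F"
  shows "card (standard_exponents \<Delta> n) = (\<Sum>F\<in>\<Delta>. card (compositions (card F) n))"
    and "finite (standard_exponents \<Delta> n)"
proof -
  let ?E = "\<lambda>F. {m. Poly_Mapping.keys m = F \<and> exp_degree m = n}"
  have E: "finite (?E F) \<and> card (?E F) = card (compositions (card F) n)" if F: "F \<in> \<Delta>" for F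
  proof -
    obtain h where "bij_betw h (?E F) (compositions (card F) n)"
      using exponents_bij_compositions[OF assms(2)[OF F]] .
    then show ?thesis
      by (simp add: bij_betw_same_card bij_betw_finite finite_compositions)
  qed
  have U: "standard_exponents \<Delta> n = (\<Union>F\<in>\<Delta>. ?E F)"
    by (auto simp: standard_exponents_def)
  show "finite (standard_exponents \<Delta> n)" unfolding U using E assms(1) by blast
  have "card (standard_exponents \<Delta> n) = (\<Sum>F\<in>\<Delta>. card (?E F))"
    unfolding U using E assms(1) by (intro card_UN_disjoint) auto
  then show "card (standard_exponents \<Delta> n) = (\<Sum>F\<in>\<Delta>. card (compositions (card F) n))"
    using E by simp
qed

lemma sum_faces_by_card:
  assumes "finite \<Delta>"
  shows "(\<Sum>F\<in>\<Delta>. card (compositions (card F) n))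
    = (\<Sum>i\<le>n. f_entry \<Delta> (int i - 1) * card (compositions i n))"
proof -
  have "(\<Sum>F\<in>\<Delta>. card (compositions (card F) n))
      = (\<Sum>F\<in>{F\<in>\<Delta>. card F \<le> n}. card (compositions (card F) n))"
    using assms by (intro sum.mono_neutral_right) (auto simp: compositions_empty not_le)
  also have "\<dots> = (\<Sum>i\<le>n. \<Sum>F | F \<in> {F\<in>\<Delta>. card F \<le> n} \<and> card F = i. card (compositions (card F) n))"
    using assms by (intro sum.group[symmetric]) auto
  also have "\<dots> = (\<Sum>i\<le>n. f_entry \<Delta> (int i - 1) * card (compositions i n))"
  proof (rule sum.cong)
    fix i assume "i \<in> {..n}"
    then have "(\<Sum>F | F \<in> {F\<in>\<Delta>. card F \<le> n} \<and> card F = i. card (compositions (card F) n))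
        = (\<Sum>F | F \<in> \<Delta> \<and> face_dim F = int i - 1. card (compositions i n))"
      by (intro sum.cong) (auto simp: face_dim_def)
    then show "(\<Sum>F | F \<in> {F\<in>\<Delta>. card F \<le> n} \<and> card F = i. card (compositions (card F) n))
      = f_entry \<Delta> (int i - 1) * card (compositions i n)"
      by (simp add: f_entry_def)
  qed simp
  finally show ?thesis .
qed

section \<open>Hilbert series of Veronese algebras\<close>

text \<open>
  Graded algebras are records that extend ring records, and the ring predicate applies to the whole
  record; this transfers it to records with other fields for the grading.
\<close>

lemma ring_cong:
  assumes "ring R" "carrier S = carrier R" "monoid.mult S = monoid.mult R" "one S = one R"
    "zero S = zero R" "add S = add R"
  shows "ring S"
proof -
  interpret ring R by fact
  show ?thesis
  proof (rule ringI)
    show "abelian_group S"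
    proof (rule abelian_groupI)
      fix x assume "x \<in> carrier S"
      then show "\<exists>y\<in>carrier S. y \<oplus>\<^bsub>S\<^esub> x = \<zero>\<^bsub>S\<^esub>"
        using l_neg by (intro bexI[of _ "a_inv R x"]) (auto simp: assms)
    next
      fix x y assume "x \<in> carrier S" "y \<in> carrier S"
      then show "x \<oplus>\<^bsub>S\<^esub> y = y \<oplus>\<^bsub>S\<^esub> x" by (simp add: assms a_comm)
    qed (auto simp: assms a_assoc)
    show "Group.monoid S"
      by (rule monoidI) (auto simp: assms m_assoc)
  qed (auto simp: assms l_distr r_distr)
qed

lemma line_extension_cong:
  assumes "ring R" "ring S" "monoid.mult S = monoid.mult R" "add S = add R"
  shows "ring.line_extension S K v E = ring.line_extension R K v E"
  using assms by (simp add: ring.line_extension_def r_coset_def set_add_def set_mult_def)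

text \<open>
  A chain of line extensions that builds \<open>E\<close> can be carried out inside any subring containing \<open>E\<close>:
  every vector used in the chain already lies in \<open>E\<close>. So the two rings agree on which numbers are
  dimensions of \<open>E\<close>, and in particular on the number that is chosen.
\<close>

lemma dim_subring:
  assumes R: "ring R" and S: "ring S" and sub: "carrier S \<subseteq> carrier R"
    and eq: "monoid.mult S = monoid.mult R" "one S = one R" "zero S = zero R" "add S = add R"
    and K: "subring K R" and E: "E \<subseteq> carrier S"
  shows "ring.dim S K E = ring.dim R K E"
proof -
  interpret R: ring R by fact
  interpret S: ring S by fact
  note line = line_extension_cong[OF R S eq(1,4)]
  have 1: "R.dimension n K F" if "S.dimension n K F" for n F
    using that
  proof induction
    case (zero_dim K)
    show ?case unfolding eq(3) by (rule R.zero_dim)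
  next
    case (Suc_dim v F n K)
    then show ?case using sub unfolding line by (intro R.Suc_dim) auto
  qed
  have "F \<subseteq> carrier R \<and> \<zero>\<^bsub>R\<^esub> \<in> F \<and> (F \<subseteq> carrier S \<longrightarrow> S.dimension n K F)"
    if "R.dimension n K F" "subring K R" for n F
    using that
  proof induction
    case (zero_dim K)
    show ?case using S.zero_dim unfolding eq(3) by auto
  next
    case (Suc_dim v F n K)
    note KR = subringE(1-3)[OF Suc_dim.prems]
    let ?L = "R.line_extension K v F"
    have F: "F \<subseteq> carrier R" "\<zero>\<^bsub>R\<^esub> \<in> F" using Suc_dim by auto
    have FL: "F \<subseteq> ?L"
    proof
      fix f assume "f \<in> F"
      moreover from this have "f = \<zero>\<^bsub>R\<^esub> \<otimes>\<^bsub>R\<^esub> v \<oplus>\<^bsub>R\<^esub> f" using F Suc_dim(1) by auto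
      ultimately show "f \<in> ?L" using KR unfolding R.line_extension_mem_iff by blast
    qed
    have "v = \<one>\<^bsub>R\<^esub> \<otimes>\<^bsub>R\<^esub> v \<oplus>\<^bsub>R\<^esub> \<zero>\<^bsub>R\<^esub>" using Suc_dim(1) by simp
    then have vL: "v \<in> ?L" using F KR unfolding R.line_extension_mem_iff by blast
    have "S.dimension (Suc n) K ?L" if "?L \<subseteq> carrier S"
      unfolding line[symmetric] using that FL vL Suc_dim by (intro S.Suc_dim) auto
    moreover have "?L \<subseteq> carrier R"
      using KR F Suc_dim(1) by (intro R.line_extension_in_carrier)
    ultimately show ?case using F FL by blast
  qed
  with 1 K E have "S.dimension n K E \<longleftrightarrow> R.dimension n K E" for n by blast
  then show ?thesis by (simp add: R.dim_def S.dim_def)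
qed

text \<open>
  The sum of the selected components is closed under products because the multiples of \<open>r\<close> form
  an additive monoid; for general elements this extends along both factors of the generated
  additive subgroup.
\<close>

lemma subring_veronese:
  fixes A (structure)
  assumes A: "ring A"
    and carr: "\<And>n. component A n \<subseteq> carrier A"
    and one: "\<one> \<in> component A 0"
    and mult: "\<And>m n a b. a \<in> component A m \<Longrightarrow> b \<in> component A n \<Longrightarrow> a \<otimes> b \<in> component A (m + n)"
  shows "subring (carrier (veronese r A)) A"
proof -
  interpret ring A by fact
  let ?C = "\<Union>n. component A (n * r)"
  let ?G = "generate (add_monoid A) ?C"
  have C: "?C \<subseteq> carrier A" using carr by auto
  have sub: "subgroup ?G (add_monoid A)" by (rule add.generate_is_subgroup[OF C])
  have G: "?G \<subseteq> carrier A" using add.subgroupE(1)[OF sub] by simp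
  have neg: "\<ominus> x \<in> ?G" if "x \<in> ?G" for x using add.subgroupE(3)[OF sub] that by simp
  have add: "x \<oplus> y \<in> ?G" if "x \<in> ?G" "y \<in> ?G" for x y using add.subgroupE(4)[OF sub] that by simp
  have zero: "\<zero> \<in> ?G" using generate.one[of "add_monoid A"] by simp
  have CG: "x \<in> ?G" if "x \<in> ?C" for x by (rule generate.incl[OF that])
  have CC: "x \<otimes> y \<in> ?C" if xy: "x \<in> ?C" "y \<in> ?C" for x y
  proof -
    from xy obtain m n where "x \<in> component A (m * r)" "y \<in> component A (n * r)" by blast
    then have "x \<otimes> y \<in> component A ((m + n) * r)" using mult by (simp add: distrib_right)
    then show ?thesis by blast
  qed
  have 1: "x \<otimes> y \<in> ?G" if x: "x \<in> ?C" and y: "y \<in> ?G" for x y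
    using y
  proof induction
    case one
    have "x \<otimes> \<zero> = \<zero>" by (rule r_null[OF subsetD[OF C x]])
    then show ?case using zero by simp
  next
    case (incl h)
    then show ?case by (rule CG[OF CC[OF x]])
  next
    case (inv h)
    have "x \<otimes> (\<ominus> h) = \<ominus> (x \<otimes> h)"
      by (rule r_minus[OF subsetD[OF C x] subsetD[OF C inv]])
    moreover have "\<ominus> (x \<otimes> h) \<in> ?G" by (rule neg[OF CG[OF CC[OF x inv]]])
    ultimately show ?case by (simp add: a_inv_def)
  next
    case (eng h1 h2)
    have "x \<otimes> (h1 \<oplus> h2) = x \<otimes> h1 \<oplus> x \<otimes> h2"
      by (rule r_distr[OF subsetD[OF G eng(1)] subsetD[OF G eng(2)] subsetD[OF C x]])
    then show ?case using add[OF eng.IH] by simp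
  qed
  have 2: "x \<otimes> y \<in> ?G" if x: "x \<in> ?G" and y: "y \<in> ?G" for x y
    using x
  proof induction
    case one
    have "\<zero> \<otimes> y = \<zero>" by (rule l_null[OF subsetD[OF G y]])
    then show ?case using zero by simp
  next
    case (incl h)
    then show ?case by (rule 1[OF _ y])
  next
    case (inv h)
    have "(\<ominus> h) \<otimes> y = \<ominus> (h \<otimes> y)"
      by (rule l_minus[OF subsetD[OF C inv] subsetD[OF G y]])
    moreover have "\<ominus> (h \<otimes> y) \<in> ?G" by (rule neg[OF 1[OF inv y]])
    ultimately show ?case by (simp add: a_inv_def)
  next
    case (eng h1 h2)
    have "(h1 \<oplus> h2) \<otimes> y = h1 \<otimes> y \<oplus> h2 \<otimes> y"
      by (rule l_distr[OF subsetD[OF G eng(1)] subsetD[OF G eng(2)] subsetD[OF G y]])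
    then show ?case using add[OF eng.IH] by simp
  qed
  have "\<one> \<in> ?C" using one by (intro UN_I[of 0]) simp_all
  then have "subring ?G A"
    by (rule subringI[OF G CG neg 2 add])
  then show ?thesis by (simp add: veronese_def)
qed

text \<open>
  The components of the Veronese algebra are components of \<open>A\<close>, and their dimension does not depend
  on whether it is computed in \<open>A\<close> or in the subring.
\<close>

lemma hilbert_series_veronese_nth:
  fixes A (structure)
  assumes A: "ring A"
    and carr: "\<And>n. component A n \<subseteq> carrier A"
    and one: "\<one> \<in> component A 0"
    and mult: "\<And>m n a b. a \<in> component A m \<Longrightarrow> b \<in> component A n \<Longrightarrow> a \<otimes> b \<in> component A (m + n)"
    and K: "subring (base_field A) A"
  shows "fps_nth (hilbert_series (veronese r A)) n = fps_nth (hilbert_series A) (n * r)"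
proof -
  note sub = subring_veronese[OF A carr one mult, of r]
  have "ring (veronese r A)"
    by (rule ring_cong[OF ring.subring_is_ring[OF A sub]]) (simp_all add: veronese_def)
  moreover have "component A (n * r) \<subseteq> carrier (veronese r A)"
    by (auto simp: veronese_def intro: generate.incl)
  moreover have "carrier (veronese r A) \<subseteq> carrier A"
    using subringE(1)[OF sub] .
  ultimately have "ring.dim (veronese r A) (base_field A) (component A (n * r))
      = ring.dim A (base_field A) (component A (n * r))"
    using A K by (intro dim_subring) (simp_all add: veronese_def)
  then show ?thesis by (simp add: hilbert_series_def veronese_def)
qed

section \<open>Stanley--Reisner rings\<close>

lemma mpoly_algebra_simps [simp]:
  "carrier (mpoly_algebra k \<Omega>) = mpolys \<Omega>" "monoid.mult (mpoly_algebra k \<Omega>) = (*)"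
  "one (mpoly_algebra k \<Omega>) = 1" "zero (mpoly_algebra k \<Omega>) = 0" "add (mpoly_algebra k \<Omega>) = (+)"
  "base_field (mpoly_algebra k \<Omega>) = range mconst"
  "component (mpoly_algebra k \<Omega>) n = {p \<in> mpolys \<Omega>. \<forall>m\<in>Poly_Mapping.keys p. exp_degree m = n}"
  by (simp_all add: mpoly_algebra_def)

lemma keys_add_nat: "Poly_Mapping.keys (a + b) = Poly_Mapping.keys a \<union> Poly_Mapping.keys b"
  for a b :: "'v \<Rightarrow>\<^sub>0 nat"
  by (auto simp: in_keys_iff lookup_add)

lemma keys_uminus: "Poly_Mapping.keys (- p) = Poly_Mapping.keys p"
  for p :: "'a \<Rightarrow>\<^sub>0 'b::ab_group_add"
  by (auto simp: in_keys_iff)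

lemma exp_degree_add: "exp_degree (a + b) = exp_degree a + exp_degree b"
proof -
  have ext: "exp_degree m = (\<Sum>v\<in>Poly_Mapping.keys a \<union> Poly_Mapping.keys b. Poly_Mapping.lookup m v)"
    if "Poly_Mapping.keys m \<subseteq> Poly_Mapping.keys a \<union> Poly_Mapping.keys b" for m :: "'a \<Rightarrow>\<^sub>0 nat"
    unfolding exp_degree_def using that
    by (intro sum.mono_neutral_left) (auto simp: in_keys_iff)
  show ?thesis
    by (simp add: ext keys_add_nat lookup_add sum.distrib)
qed

lemma mult_keysE:
  assumes "m \<in> Poly_Mapping.keys (p * q)"
  obtains a b where "m = a + b" "a \<in> Poly_Mapping.keys p" "b \<in> Poly_Mapping.keys q"
  using assms keys_mult[of p q] by blast

lemma mpolys_closed: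
  fixes p q :: "('v, 'k::field) mpoly"
  shows "0 \<in> mpolys \<Omega>" "1 \<in> mpolys \<Omega>" "mconst c \<in> mpolys \<Omega>"
    and "p \<in> mpolys \<Omega> \<Longrightarrow> - p \<in> mpolys \<Omega>"
    and "p \<in> mpolys \<Omega> \<Longrightarrow> q \<in> mpolys \<Omega> \<Longrightarrow> p + q \<in> mpolys \<Omega>"
    and "p \<in> mpolys \<Omega> \<Longrightarrow> q \<in> mpolys \<Omega> \<Longrightarrow> p * q \<in> mpolys \<Omega>"
proof -
  show "0 \<in> mpolys \<Omega>" "1 \<in> mpolys \<Omega>" "mconst c \<in> mpolys \<Omega>"
    by (auto simp: mpolys_def mconst_def)
  show "p \<in> mpolys \<Omega> \<Longrightarrow> - p \<in> mpolys \<Omega>" by (simp add: mpolys_def keys_uminus)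
  show "p \<in> mpolys \<Omega> \<Longrightarrow> q \<in> mpolys \<Omega> \<Longrightarrow> p + q \<in> mpolys \<Omega>"
    using keys_add[of p q] by (fastforce simp: mpolys_def)
  show "p \<in> mpolys \<Omega> \<Longrightarrow> q \<in> mpolys \<Omega> \<Longrightarrow> p * q \<in> mpolys \<Omega>"
    unfolding mpolys_def by (fastforce simp: keys_add_nat elim!: mult_keysE)
qed

lemma ring_mpoly_algebra: "ring (mpoly_algebra k \<Omega>)"
proof (rule ringI)
  show "abelian_group (mpoly_algebra k \<Omega>)"
  proof (rule abelian_groupI)
    fix x assume "x \<in> carrier (mpoly_algebra k \<Omega>)"
    then have "- x \<in> mpolys \<Omega>" by (auto intro: mpolys_closed)
    then show "\<exists>y\<in>carrier (mpoly_algebra k \<Omega>). y \<oplus>\<^bsub>mpoly_algebra k \<Omega>\<^esub> x = \<zero>\<^bsub>mpoly_algebra k \<Omega>\<^esub>"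
      by (intro bexI[of _ "- x"]) simp_all
  qed (simp_all add: mpolys_closed add_ac)
  show "Group.monoid (mpoly_algebra k \<Omega>)"
    by (rule monoidI) (simp_all add: mpolys_closed mult.assoc)
qed (simp_all add: distrib_left distrib_right)

lemma a_inv_mpoly_algebra: "p \<in> mpolys \<Omega> \<Longrightarrow> a_inv (mpoly_algebra k \<Omega>) p = - p"
proof -
  interpret ring "mpoly_algebra k \<Omega>" by (rule ring_mpoly_algebra)
  assume "p \<in> mpolys \<Omega>"
  then show ?thesis by (intro minus_equality) (simp_all add: mpolys_closed)
qed

lemma subfield_mconst: "subfield (range mconst) (mpoly_algebra (k :: 'k::field itself) \<Omega>)"
proof -
  interpret ring "mpoly_algebra k \<Omega>" by (rule ring_mpoly_algebra)
  have mult: "mconst a * mconst b = mconst (a * b)" and add: "mconst a + mconst b = mconst (a + b)"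
    and neg: "- mconst a = mconst (- a)" for a b :: 'k
    by (simp_all add: mconst_def mult_single single_add single_uminus)
  have one: "mconst 1 = 1" and zero: "mconst 0 = 0" by (simp_all add: mconst_def)
  have "subring (range mconst) (mpoly_algebra k \<Omega>)"
  proof (rule subringI)
    show "\<one>\<^bsub>mpoly_algebra k \<Omega>\<^esub> \<in> range mconst" using one by (metis mpoly_algebra_simps(3) rangeI)
  qed (auto simp: mult add neg a_inv_mpoly_algebra mpolys_closed)
  then have "subcring (range mconst) (mpoly_algebra k \<Omega>)"
    by (rule subcringI) (simp add: mult.commute)
  moreover have "Units (mpoly_algebra k \<Omega>\<lparr>carrier := range mconst\<rparr>) = range mconst - {\<zero>\<^bsub>mpoly_algebra k \<Omega>\<^esub>}"
  proof (intro equalityI subsetI)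
    fix x :: "('a, 'k) mpoly"
    assume "x \<in> Units (mpoly_algebra k \<Omega>\<lparr>carrier := range mconst\<rparr>)"
    then show "x \<in> range mconst - {\<zero>\<^bsub>mpoly_algebra k \<Omega>\<^esub>}" by (auto simp: Units_def)
  next
    fix x :: "('a, 'k) mpoly"
    assume "x \<in> range mconst - {\<zero>\<^bsub>mpoly_algebra k \<Omega>\<^esub>}"
    then obtain c where c: "x = mconst c" "c \<noteq> 0" using zero by auto
    then have "mconst (inverse c) * x = 1" by (simp add: mult one)
    then show "x \<in> Units (mpoly_algebra k \<Omega>\<lparr>carrier := range mconst\<rparr>)"
      using c by (auto simp: Units_def mult.commute)
  qed
  ultimately show ?thesis by (rule subfieldI)
qed

lemma prod_mvar:
  assumes "finite B"
  shows "\<exists>e. (\<Prod>\<omega>\<in>B. mvar \<omega> :: ('v, 'k::field) mpoly) = Poly_Mapping.single e 1 \<and>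
    (\<forall>v. Poly_Mapping.lookup e v = (if v \<in> B then 1 else 0))"
  using assms
proof induction
  case empty
  show ?case by (intro exI[of _ 0]) simp
next
  case (insert x B)
  then obtain e where "(\<Prod>\<omega>\<in>B. mvar \<omega> :: ('v, 'k) mpoly) = Poly_Mapping.single e 1"
    "\<And>v. Poly_Mapping.lookup e v = (if v \<in> B then 1 else 0)" by blast
  with insert show ?case
    by (intro exI[of _ "Poly_Mapping.single x 1 + e"])
       (auto simp: mvar_def mult_single lookup_add lookup_single when_def)
qed

lemma keys_remove_term:
  fixes p :: "'a \<Rightarrow>\<^sub>0 'b::ab_group_add"
  assumes "Poly_Mapping.keys p \<subseteq> insert m M"
  shows "Poly_Mapping.keys (p - Poly_Mapping.single m (Poly_Mapping.lookup p m)) \<subseteq> M"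
proof
  fix x assume x: "x \<in> Poly_Mapping.keys (p - Poly_Mapping.single m (Poly_Mapping.lookup p m))"
  then have "x \<noteq> m" "Poly_Mapping.lookup p x \<noteq> 0"
    by (auto simp: in_keys_iff lookup_minus lookup_single when_def split: if_splits)
  then show "x \<in> M" using assms by (auto simp: in_keys_iff)
qed

text \<open>
  An explicit description of the Stanley--Reisner ideal as a span of monomials, so that
  membership can be tested term by term.
\<close>

definition nonface_polys :: "'v set \<Rightarrow> 'v set set \<Rightarrow> ('v, 'k::field) mpoly set" where
  "nonface_polys \<Omega> \<Delta> = {p \<in> mpolys \<Omega>. \<forall>m\<in>Poly_Mapping.keys p. Poly_Mapping.keys m \<notin> \<Delta>}"

text \<open>
  Multiplying a monomial by another one enlarges its support, and the nonfaces are closed under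
  supersets.
\<close>

lemma ideal_nonface_polys:
  assumes "simplicial_complex \<Omega> \<Delta>"
  shows "ideal (nonface_polys \<Omega> \<Delta>) (mpoly_algebra (k :: 'k::field itself) \<Omega>)"
proof -
  interpret ring "mpoly_algebra k \<Omega>" by (rule ring_mpoly_algebra)
  let ?N = "nonface_polys \<Omega> \<Delta> :: ('a, 'k) mpoly set"
  have down: "A \<in> \<Delta>" if "A \<union> B \<in> \<Delta>" for A B
    using that assms by (auto simp: simplicial_complex_def)
  have mult: "p * q \<in> ?N" if "p \<in> ?N" "q \<in> mpolys \<Omega>" for p q
  proof -
    have "Poly_Mapping.keys m \<notin> \<Delta>" if "m \<in> Poly_Mapping.keys (p * q)" for m
    proof -
      from that obtain a b where m: "m = a + b" "a \<in> Poly_Mapping.keys p" by (rule mult_keysE)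
      then have "Poly_Mapping.keys a \<notin> \<Delta>" using \<open>p \<in> ?N\<close> by (simp add: nonface_polys_def)
      then show ?thesis unfolding m(1) keys_add_nat using down by blast
    qed
    then show ?thesis using that mpolys_closed(6)[of p \<Omega> q] by (simp add: nonface_polys_def)
  qed
  show ?thesis
  proof (rule idealI[OF ring_axioms])
    show "subgroup ?N (add_monoid (mpoly_algebra k \<Omega>))"
    proof (rule add.subgroupI)
      show "?N \<noteq> {}" by (auto simp: nonface_polys_def intro!: exI[of _ 0] mpolys_closed)
      show "\<ominus>\<^bsub>mpoly_algebra k \<Omega>\<^esub> p \<in> ?N" if "p \<in> ?N" for p
        using that by (simp add: nonface_polys_def a_inv_mpoly_algebra keys_uminus mpolys_closed)
      show "p \<oplus>\<^bsub>mpoly_algebra k \<Omega>\<^esub> q \<in> ?N" if "p \<in> ?N" "q \<in> ?N" for p q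
        using that keys_add[of p q] by (fastforce simp: nonface_polys_def mpolys_closed)
    qed (auto simp: nonface_polys_def)
    show "x \<otimes>\<^bsub>mpoly_algebra k \<Omega>\<^esub> a \<in> ?N" "a \<otimes>\<^bsub>mpoly_algebra k \<Omega>\<^esub> x \<in> ?N"
      if "a \<in> ?N" "x \<in> carrier (mpoly_algebra k \<Omega>)" for a x
      using mult[of a x] that by (simp_all add: mult.commute)
  qed
qed

text \<open>
  A monomial whose support \<open>B\<close> is not a face is divisible by the generator belonging to \<open>B\<close>, so
  every ideal containing the generators contains all such monomials and hence their span.
\<close>

lemma stanley_reisner_ideal_eq:
  assumes "simplicial_complex \<Omega> \<Delta>"
  shows "stanley_reisner_ideal (k :: 'k::field itself) \<Omega> \<Delta> = nonface_polys \<Omega> \<Delta>"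
proof -
  interpret ring "mpoly_algebra k \<Omega>" by (rule ring_mpoly_algebra)
  let ?S = "{\<Prod>\<omega>\<in>B. mvar \<omega> | B. B \<subseteq> \<Omega> \<and> B \<notin> \<Delta>} :: ('a, 'k) mpoly set"
  let ?N = "nonface_polys \<Omega> \<Delta> :: ('a, 'k) mpoly set"
  have fin: "finite B" if "B \<subseteq> \<Omega>" for B
    using that assms finite_subset by (auto simp: simplicial_complex_def)
  have SN: "?S \<subseteq> ?N"
  proof
    fix p assume "p \<in> ?S"
    then obtain B where B: "p = (\<Prod>\<omega>\<in>B. mvar \<omega>)" "B \<subseteq> \<Omega>" "B \<notin> \<Delta>" by blast
    obtain e where e: "p = Poly_Mapping.single e 1"
      "\<And>v. Poly_Mapping.lookup e v = (if v \<in> B then 1 else 0)"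
      using prod_mvar[OF fin[OF B(2)]] B(1) by blast
    have "Poly_Mapping.keys e = B" by (auto simp: in_keys_iff e(2) split: if_splits)
    then show "p \<in> ?N" unfolding e(1) using B(2,3) by (simp add: nonface_polys_def mpolys_def)
  qed
  have "?N \<subseteq> J" if J: "ideal J (mpoly_algebra k \<Omega>)" "?S \<subseteq> J" for J
  proof -
    interpret J: ideal J "mpoly_algebra k \<Omega>" by fact
    have monomial: "Poly_Mapping.single m c \<in> J" if m: "Poly_Mapping.keys m \<subseteq> \<Omega>" "Poly_Mapping.keys m \<notin> \<Delta>"
      for m and c :: 'k
    proof -
      obtain e where e: "(\<Prod>\<omega>\<in>Poly_Mapping.keys m. mvar \<omega> :: ('a, 'k) mpoly) = Poly_Mapping.single e 1"
        "\<And>v. Poly_Mapping.lookup e v = (if v \<in> Poly_Mapping.keys m then 1 else 0)"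
        using prod_mvar[of "Poly_Mapping.keys m"] by auto
      have gen: "Poly_Mapping.single e 1 \<in> J" using J(2) m e(1)[symmetric] by blast
      have split: "m = (m - e) + e"
        by (rule poly_mapping_eqI) (auto simp: lookup_add lookup_minus e(2) in_keys_iff)
      have "Poly_Mapping.keys (m - e) \<subseteq> \<Omega>"
        using m(1) by (auto simp: in_keys_iff lookup_minus)
      then have "Poly_Mapping.single (m - e) c \<in> mpolys \<Omega>" by (simp add: mpolys_def)
      then have "Poly_Mapping.single (m - e) c * Poly_Mapping.single e 1 \<in> J"
        using J.I_l_closed[OF gen] by simp
      then show ?thesis by (simp add: mult_single split[symmetric])
    qed
    have "p \<in> J" if "finite M" "Poly_Mapping.keys p \<subseteq> M" "\<forall>m\<in>M. Poly_Mapping.keys m \<subseteq> \<Omega> \<and> Poly_Mapping.keys m \<notin> \<Delta>"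
      for M and p :: "('a, 'k) mpoly"
      using that
    proof (induction M arbitrary: p)
      case empty
      then have "p = 0" by simp
      then show ?case using J.zero_closed by simp
    next
      case (insert m M)
      let ?t = "Poly_Mapping.single m (Poly_Mapping.lookup p m)"
      have "p - ?t \<in> J" using insert keys_remove_term[OF insert.prems(1)] by blast
      moreover have "?t \<in> J" using insert.prems by (intro monomial) auto
      ultimately show ?case using J.a_closed[of "p - ?t" ?t] by simp
    qed
    from this[OF finite_keys subset_refl] show ?thesis
      by (auto simp: nonface_polys_def mpolys_def)
  qed
  then show ?thesis
    unfolding stanley_reisner_ideal_def genideal_def using ideal_nonface_polys[OF assms] SN by blast
qed

text \<open>
  Adjoining a monomial to \<open>M\<close> extends the span by the line through that monomial.
\<close>

lemma dimension_mpolys_span: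
  assumes "finite M" "\<forall>m\<in>M. Poly_Mapping.keys m \<subseteq> \<Omega>"
  shows "ring.dimension (mpoly_algebra (k :: 'k::field itself) \<Omega>) (card M) (range mconst)
    {p. Poly_Mapping.keys p \<subseteq> M}"
  using assms
proof induction
  interpret ring "mpoly_algebra k \<Omega>" by (rule ring_mpoly_algebra)
  {
    case empty
    have "{p :: ('a, 'k) mpoly. Poly_Mapping.keys p \<subseteq> {}} = {\<zero>\<^bsub>mpoly_algebra k \<Omega>\<^esub>}" by auto
    then show ?case using zero_dim by (metis card.empty)
  next
    case (insert m M)
    let ?E = "{p :: ('a, 'k) mpoly. Poly_Mapping.keys p \<subseteq> M}"
    let ?m = "Poly_Mapping.single m 1 :: ('a, 'k) mpoly"
    have "line_extension (range mconst) ?m ?E = {p. Poly_Mapping.keys p \<subseteq> insert m M}"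
    proof (intro equalityI subsetI)
      fix p assume "p \<in> line_extension (range mconst) ?m ?E"
      then obtain c q where "p = mconst c * ?m + q" "Poly_Mapping.keys q \<subseteq> M"
        by (auto simp: line_extension_mem_iff)
      then show "p \<in> {p. Poly_Mapping.keys p \<subseteq> insert m M}"
        using keys_add[of "mconst c * ?m" q] by (auto simp: mconst_def mult_single split: if_splits)
    next
      fix p :: "('a, 'k) mpoly" assume p: "p \<in> {p. Poly_Mapping.keys p \<subseteq> insert m M}"
      let ?c = "Poly_Mapping.lookup p m"
      have "p = mconst ?c * ?m + (p - Poly_Mapping.single m ?c)"
        by (simp add: mconst_def mult_single)
      then show "p \<in> line_extension (range mconst) ?m ?E"
        using keys_remove_term[of p m M] p unfolding line_extension_mem_iff
        by (intro bexI[of _ "mconst ?c"] bexI[of _ "p - Poly_Mapping.single m ?c"]) simp_all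
    qed
    moreover have "?m \<in> carrier (mpoly_algebra k \<Omega>)"
      using insert.prems by (simp add: mpolys_def)
    moreover have "?m \<notin> ?E" using insert.hyps by simp
    ultimately show ?case
      using Suc_dim[of ?m ?E "card M" "range mconst"] insert by simp
  }
qed

lemma stanley_reisner_ring_fields:
  fixes k :: "'k::field itself" and \<Omega> :: "'v set" and \<Delta> :: "'v set set"
  defines "P \<equiv> mpoly_algebra k \<Omega>" and "I \<equiv> stanley_reisner_ideal k \<Omega> \<Delta>"
    and "A \<equiv> stanley_reisner_ring k \<Omega> \<Delta>"
  shows "carrier A = carrier (P Quot I)" "monoid.mult A = monoid.mult (P Quot I)"
    "one A = one (P Quot I)" "zero A = zero (P Quot I)" "add A = add (P Quot I)"
    "base_field A = (+>\<^bsub>P\<^esub>) I ` base_field P" "component A n = (+>\<^bsub>P\<^esub>) I ` component P n"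
  unfolding A_def I_def P_def stanley_reisner_ring_def quotient_algebra_def
  by (simp_all add: ring.defs graded_algebra.defs)

lemma stanley_reisner_ring_hom:
  assumes "simplicial_complex \<Omega> \<Delta>"
  shows "ring_hom_ring (mpoly_algebra k \<Omega>) (stanley_reisner_ring k \<Omega> \<Delta>)
     ((+>\<^bsub>mpoly_algebra k \<Omega>\<^esub>) (nonface_polys \<Omega> \<Delta>))"
proof -
  interpret ideal "nonface_polys \<Omega> \<Delta>" "mpoly_algebra k \<Omega>" by (rule ideal_nonface_polys[OF assms])
  note f = stanley_reisner_ring_fields[of k \<Omega> \<Delta>, unfolded stanley_reisner_ideal_eq[OF assms]]
  have "ring (stanley_reisner_ring k \<Omega> \<Delta>)"
    by (rule ring_cong[OF quotient_is_ring]) (rule f)+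
  moreover have "(+>\<^bsub>mpoly_algebra k \<Omega>\<^esub>) (nonface_polys \<Omega> \<Delta>)
      \<in> ring_hom (mpoly_algebra k \<Omega>) (stanley_reisner_ring k \<Omega> \<Delta>)"
    using rcos_ring_hom by (simp add: ring_hom_def f)
  ultimately show ?thesis by (rule ring_hom_ringI2[OF ring_axioms])
qed

text \<open>
  The support of the monomial 1 is the empty set, which is a face, so 1 is not in the ideal.
\<close>

lemma zero_neq_one_stanley_reisner_ring:
  fixes k :: "'k::field itself" and \<Omega> :: "'v set"
  assumes "simplicial_complex \<Omega> \<Delta>"
  shows "\<one>\<^bsub>stanley_reisner_ring k \<Omega> \<Delta>\<^esub> \<noteq> \<zero>\<^bsub>stanley_reisner_ring k \<Omega> \<Delta>\<^esub>"
proof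
  interpret ideal "nonface_polys \<Omega> \<Delta>" "mpoly_algebra k \<Omega>" by (rule ideal_nonface_polys[OF assms])
  note f = stanley_reisner_ring_fields[of k \<Omega> \<Delta>, unfolded stanley_reisner_ideal_eq[OF assms]]
  assume "\<one>\<^bsub>stanley_reisner_ring k \<Omega> \<Delta>\<^esub> = \<zero>\<^bsub>stanley_reisner_ring k \<Omega> \<Delta>\<^esub>"
  then have "nonface_polys \<Omega> \<Delta> +>\<^bsub>mpoly_algebra k \<Omega>\<^esub> 1 = nonface_polys \<Omega> \<Delta>"
    by (simp add: f FactRing_def)
  then have "(1 :: ('v, 'k) mpoly) \<in> nonface_polys \<Omega> \<Delta>"
    using rcos_const_imp_mem[of 1] by (simp add: mpolys_closed)
  then show False using assms by (simp add: nonface_polys_def simplicial_complex_def)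
qed

lemma coset_eq_iff:
  assumes "simplicial_complex \<Omega> \<Delta>" "p \<in> mpolys \<Omega>" "q \<in> mpolys \<Omega>"
  shows "nonface_polys \<Omega> \<Delta> +>\<^bsub>mpoly_algebra k \<Omega>\<^esub> p = nonface_polys \<Omega> \<Delta> +>\<^bsub>mpoly_algebra k \<Omega>\<^esub> q
    \<longleftrightarrow> p - q \<in> nonface_polys \<Omega> \<Delta>" (is "?p = ?q \<longleftrightarrow> _")
proof -
  interpret ideal "nonface_polys \<Omega> \<Delta>" "mpoly_algebra k \<Omega>" by (rule ideal_nonface_polys[OF assms(1)])
  have mem: "x \<in> nonface_polys \<Omega> \<Delta> +>\<^bsub>mpoly_algebra k \<Omega>\<^esub> q \<longleftrightarrow> x - q \<in> nonface_polys \<Omega> \<Delta>" for x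
    by (force simp: a_r_coset_def')
  show ?thesis
  proof
    assume "?p = ?q"
    then have "p \<in> ?q" using a_rcos_self[of p] assms(2) by simp
    then show "p - q \<in> nonface_polys \<Omega> \<Delta>" by (simp add: mem)
  next
    assume "p - q \<in> nonface_polys \<Omega> \<Delta>"
    then have "p \<in> ?q" by (simp add: mem)
    then show "?p = ?q" using a_repr_independence'[of p q] assms(3) by simp
  qed
qed

lemma stanley_reisner_ring_graded:
  fixes k :: "'k::field itself" and \<Omega> :: "'v set" and \<Delta> :: "'v set set"
  assumes "simplicial_complex \<Omega> \<Delta>"
  defines "A \<equiv> stanley_reisner_ring k \<Omega> \<Delta>"
  shows "ring A" "subfield (base_field A) A" "component A n \<subseteq> carrier A" "\<one>\<^bsub>A\<^esub> \<in> component A 0"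
    and "\<And>a b. a \<in> component A m \<Longrightarrow> b \<in> component A n \<Longrightarrow> a \<otimes>\<^bsub>A\<^esub> b \<in> component A (m + n)"
proof -
  let ?P = "mpoly_algebra k \<Omega>" and ?h = "(+>\<^bsub>mpoly_algebra k \<Omega>\<^esub>) (nonface_polys \<Omega> \<Delta>)"
  interpret ring_hom_ring ?P A ?h unfolding A_def by (rule stanley_reisner_ring_hom[OF assms(1)])
  note f = stanley_reisner_ring_fields(6,7)[of k \<Omega> \<Delta>, unfolded stanley_reisner_ideal_eq[OF assms(1)],
      folded A_def]
  show "ring A" by (rule S.ring_axioms)
  show "subfield (base_field A) A"
    unfolding f using img_is_subfield(2)[OF subfield_mconst]
      zero_neq_one_stanley_reisner_ring[OF assms(1), of k] by (simp add: A_def)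
  show "component A n \<subseteq> carrier A" for n
    unfolding f using hom_closed by auto
  have "1 \<in> component ?P 0" by (auto simp: exp_degree_def intro: mpolys_closed)
  then have "?h 1 \<in> component A 0" unfolding f by (rule imageI)
  then show "\<one>\<^bsub>A\<^esub> \<in> component A 0" using hom_one by simp
  fix a b assume "a \<in> component A m" "b \<in> component A n"
  then obtain p q where p: "a = ?h p" "p \<in> component ?P m" and q: "b = ?h q" "q \<in> component ?P n"
    unfolding f by blast
  have "p * q \<in> component ?P (m + n)"
    using p(2) q(2) by (auto simp: exp_degree_add mpolys_closed elim!: mult_keysE)
  then have "?h (p * q) \<in> component A (m + n)" unfolding f by (rule imageI)
  moreover have "?h (p * q) = a \<otimes>\<^bsub>A\<^esub> b"
    using hom_mult[of p q] p q by simp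
  ultimately show "a \<otimes>\<^bsub>A\<^esub> b \<in> component A (m + n)" by simp
qed

text \<open>
  Modulo the ideal, the terms of a homogeneous polynomial whose support is not a face can be
  discarded.
\<close>

lemma component_stanley_reisner_ring:
  fixes k :: "'k::field itself"
  assumes "simplicial_complex \<Omega> \<Delta>"
  shows "component (stanley_reisner_ring k \<Omega> \<Delta>) n =
    (+>\<^bsub>mpoly_algebra k \<Omega>\<^esub>) (nonface_polys \<Omega> \<Delta>) ` {p. Poly_Mapping.keys p \<subseteq> standard_exponents \<Delta> n}"
    (is "_ = ?h ` ?E")
proof -
  let ?C = "component (mpoly_algebra k \<Omega>) n"
  have EC: "?E \<subseteq> ?C"
    using assms by (auto simp: standard_exponents_def simplicial_complex_def mpolys_def subset_iff)
  have "?h p \<in> ?h ` ?E" if p: "p \<in> ?C" for p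
  proof -
    \<comment> \<open>the part of \<open>p\<close> supported on faces\<close>
    let ?q = "Poly_Mapping.mapp (\<lambda>m c. if Poly_Mapping.keys m \<in> \<Delta> then c else 0) p"
    have l: "Poly_Mapping.lookup ?q m = (if Poly_Mapping.keys m \<in> \<Delta> then Poly_Mapping.lookup p m else 0)" for m
      by (simp add: mapp.rep_eq when_def in_keys_iff)
    have "Poly_Mapping.keys ?q \<subseteq> standard_exponents \<Delta> n"
      using p by (auto simp: in_keys_iff l standard_exponents_def split: if_splits)
    then have q: "?q \<in> ?E" by simp
    have "p - ?q \<in> nonface_polys \<Omega> \<Delta>"
      using p by (auto simp: nonface_polys_def mpolys_def in_keys_iff lookup_minus l split: if_splits)
    then have "?h p = ?h ?q"
      using coset_eq_iff[OF assms, of p ?q k] p q EC by auto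
    with q show ?thesis by blast
  qed
  with EC have "?h ` ?C = ?h ` ?E" by blast
  then show ?thesis
    by (simp add: stanley_reisner_ring_fields(7) stanley_reisner_ideal_eq[OF assms])
qed

text \<open>
  The span of the monomials of degree \<open>n\<close> supported on faces meets the ideal only in 0, so the
  projection maps it isomorphically onto the component of degree \<open>n\<close>.
\<close>

lemma hilbert_series_stanley_reisner_nth:
  fixes k :: "'k::field itself"
  assumes "simplicial_complex \<Omega> \<Delta>"
  shows "fps_nth (hilbert_series (stanley_reisner_ring k \<Omega> \<Delta>)) n =
    int (\<Sum>F\<in>\<Delta>. card (compositions (card F) n))"
proof -
  let ?P = "mpoly_algebra k \<Omega>" and ?h = "(+>\<^bsub>mpoly_algebra k \<Omega>\<^esub>) (nonface_polys \<Omega> \<Delta>)"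
  let ?A = "stanley_reisner_ring k \<Omega> \<Delta>"
  let ?M = "standard_exponents \<Delta> n" let ?E = "{p :: ('a, 'k) mpoly. Poly_Mapping.keys p \<subseteq> ?M}"
  interpret ring_hom_ring ?P ?A ?h by (rule stanley_reisner_ring_hom[OF assms])
  have fin: "finite \<Delta>" "F \<in> \<Delta> \<Longrightarrow> finite F" for F
    using assms finite_subset[of \<Delta> "Pow \<Omega>"] finite_subset[of F \<Omega>] by (auto simp: simplicial_complex_def)
  have M: "\<forall>m\<in>?M. Poly_Mapping.keys m \<subseteq> \<Omega>"
    using assms by (auto simp: standard_exponents_def simplicial_complex_def)
  have EP: "?E \<subseteq> mpolys \<Omega>" using M by (auto simp: mpolys_def)
  have "inj_on ?h ?E"
  proof (rule inj_onI)
    fix p q assume pq: "p \<in> ?E" "q \<in> ?E" "?h p = ?h q"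
    then have "p - q \<in> nonface_polys \<Omega> \<Delta>"
      using coset_eq_iff[OF assms, of p q k] EP by auto
    moreover have "Poly_Mapping.keys (p - q) \<subseteq> ?M"
      using pq keys_add[of p "- q"] by (auto simp: keys_uminus)
    ultimately have "Poly_Mapping.keys (p - q) = {}"
      unfolding nonface_polys_def standard_exponents_def by blast
    then show "p = q" by simp
  qed
  then have "S.dimension (card ?M) (?h ` range mconst) (?h ` ?E)"
    using inj_hom_dimension[OF subfield_mconst _ _ dimension_mpolys_span[OF card_standard_exponents(2)[OF fin] M]]
      zero_neq_one_stanley_reisner_ring[OF assms] by blast
  then have dim: "S.dimension (card ?M) (base_field ?A) (component ?A n)"
    unfolding component_stanley_reisner_ring[OF assms]
    by (simp add: stanley_reisner_ring_fields(6) stanley_reisner_ideal_eq[OF assms])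
  then have "S.dim (base_field ?A) (component ?A n) = card ?M"
    unfolding S.dim_def using S.dimension_is_inj[OF stanley_reisner_ring_graded(2)[OF assms]] by blast
  then show ?thesis
    by (simp add: hilbert_series_def card_standard_exponents(1)[OF fin])
qed

section \<open>The f-vector of a Veronese complex\<close>

theorem proposition4p2:
  fixes k :: "'k::field itself"
    and \<Omega> :: "'v set" and \<Delta> :: "'v set set"
    and \<Omega>' :: "'w set" and \<Delta>' :: "'w set set"
    and d r :: nat
  assumes "simplicial_complex \<Omega> \<Delta>"
    and "complex_dim \<Delta> = int d - 1"
    and "r \<ge> 1"
    and "simplicial_complex \<Omega>' \<Delta>'"
    and "hilbert_series (veronese r (stanley_reisner_ring k \<Omega> \<Delta>)) =
         hilbert_series (stanley_reisner_ring k \<Omega>' \<Delta>')"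
  shows "complex_dim \<Delta>' = int d - 1 \<and>
    (\<forall>i\<le>d. f_entry \<Delta>' (int i - 1) =
      (\<Sum>l=i..d. \<Sum>js | length js = i \<and> sum_list js = l \<and> (\<forall>j\<in>set js. j \<ge> 1).
         (case js of
            [] \<Rightarrow> 1
          | j # js' \<Rightarrow> ((r - 1) choose (j - 1)) * (\<Prod>j'\<leftarrow>js'. r choose j')) *
         f_entry \<Delta> (int l - 1)))"
proof -
  have fin: "finite \<Delta>" "finite \<Delta>'"
    using assms(1,4) by (auto simp: simplicial_complex_def intro: finite_subset[OF _ finite_Pow_iff[THEN iffD2]])
  have ne: "{} \<in> \<Delta>" "{} \<in> \<Delta>'" using assms(1,4) by (auto simp: simplicial_complex_def)
  note A = stanley_reisner_ring_graded[OF assms(1), where k = k]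

  have hilb: "(\<Sum>F\<in>\<Delta>'. card (compositions (card F) n)) = (\<Sum>F\<in>\<Delta>. card (compositions (card F) (n * r)))" for n
  proof -
    have "int (\<Sum>F\<in>\<Delta>'. card (compositions (card F) n))
        = fps_nth (hilbert_series (stanley_reisner_ring k \<Omega>' \<Delta>')) n"
      by (rule hilbert_series_stanley_reisner_nth[OF assms(4), symmetric])
    also have "\<dots> = fps_nth (hilbert_series (veronese r (stanley_reisner_ring k \<Omega> \<Delta>))) n"
      by (simp only: assms(5))
    also have "\<dots> = fps_nth (hilbert_series (stanley_reisner_ring k \<Omega> \<Delta>)) (n * r)"
      by (rule hilbert_series_veronese_nth[OF A(1,3,4,5) subfieldE(1)[OF A(2)]])
    also have "\<dots> = int (\<Sum>F\<in>\<Delta>. card (compositions (card F) (n * r)))"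
      by (rule hilbert_series_stanley_reisner_nth[OF assms(1)])
    finally show ?thesis by (simp only: of_nat_eq_iff)
  qed

  \<comment> \<open>Both sides of the hypothesis are expanded in the functions \<open>c(i, _)\<close>.\<close>
  have f': "f_entry \<Delta>' (int i - 1) = (\<Sum>F\<in>\<Delta>. veronese_coeff r i (card F))" for i
  proof (rule triangular_unique[where a = "\<lambda>i. f_entry \<Delta>' (int i - 1)"
        and b = "\<lambda>i. \<Sum>F\<in>\<Delta>. veronese_coeff r i (card F)"])
    fix n
    have "(\<Sum>i\<le>n. f_entry \<Delta>' (int i - 1) * card (compositions i n))
        = (\<Sum>F\<in>\<Delta>. card (compositions (card F) (n * r)))"
      by (simp only: sum_faces_by_card[OF fin(2), symmetric] hilb)
    also have "\<dots> = (\<Sum>F\<in>\<Delta>. \<Sum>i\<le>n. veronese_coeff r i (card F) * card (compositions i n))"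
      by (simp only: card_compositions_mult[OF assms(3)])
    also have "\<dots> = (\<Sum>i\<le>n. (\<Sum>F\<in>\<Delta>. veronese_coeff r i (card F)) * card (compositions i n))"
      by (subst sum.swap) (simp only: sum_distrib_right)
    finally show "(\<Sum>i\<le>n. f_entry \<Delta>' (int i - 1) * card (compositions i n))
      = (\<Sum>i\<le>n. (\<Sum>F\<in>\<Delta>. veronese_coeff r i (card F)) * card (compositions i n))" .
  qed

  have dim_max: "face_dim F \<le> complex_dim \<Delta>" if "F \<in> \<Delta>" for F
    unfolding complex_dim_def using fin that by (intro Max_ge) auto
  have card_le: "card F \<le> d" if "F \<in> \<Delta>" for F
    using dim_max[OF that] assms(2) by (simp add: face_dim_def)
  have "complex_dim \<Delta> \<in> face_dim ` \<Delta>"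
    unfolding complex_dim_def using fin ne by (intro Max_in) auto
  \<comment> \<open>A face of maximal size, which makes the top entry of the f-vector positive\<close>
  then obtain F0 where F0: "F0 \<in> \<Delta>" "card F0 = d"
    using assms(2) by (auto simp: face_dim_def)

  have formula: "f_entry \<Delta>' (int i - 1) = (\<Sum>l=i..d. veronese_coeff r i l * f_entry \<Delta> (int l - 1))" for i
  proof -
    have "f_entry \<Delta>' (int i - 1) = (\<Sum>F\<in>{F\<in>\<Delta>. i \<le> card F}. veronese_coeff r i (card F))"
      unfolding f' using fin by (intro sum.mono_neutral_right) (auto simp: veronese_coeff_empty not_le)
    also have "\<dots> = (\<Sum>l=i..d. \<Sum>F | F \<in> {F\<in>\<Delta>. i \<le> card F} \<and> card F = l. veronese_coeff r i (card F))"
      using fin card_le by (intro sum.group[symmetric]) auto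
    also have "\<dots> = (\<Sum>l=i..d. veronese_coeff r i l * f_entry \<Delta> (int l - 1))"
    proof (rule sum.cong)
      fix l assume "l \<in> {i..d}"
      then have "(\<Sum>F | F \<in> {F\<in>\<Delta>. i \<le> card F} \<and> card F = l. veronese_coeff r i (card F))
          = (\<Sum>F | F \<in> \<Delta> \<and> face_dim F = int l - 1. veronese_coeff r i l)"
        by (intro sum.cong) (auto simp: face_dim_def)
      then show "(\<Sum>F | F \<in> {F\<in>\<Delta>. i \<le> card F} \<and> card F = l. veronese_coeff r i (card F))
          = veronese_coeff r i l * f_entry \<Delta> (int l - 1)"
        by (auto simp: f_entry_def)
    qed simp
    finally show ?thesis .
  qed

  have "complex_dim \<Delta>' = int d - 1"
    unfolding complex_dim_def
  proof (rule Max_eqI)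
    show "finite (face_dim ` \<Delta>')" using fin by simp
    fix y assume "y \<in> face_dim ` \<Delta>'"
    then obtain F where F: "F \<in> \<Delta>'" "y = face_dim F" by blast
    have "f_entry \<Delta>' (int (card F) - 1) \<noteq> 0"
      using F fin by (auto simp: f_entry_def face_dim_def)
    then have "card F \<le> d" using formula[of "card F"] by (cases "card F \<le> d") auto
    then show "y \<le> int d - 1" using F by (simp add: face_dim_def)
  next
    have "f_entry \<Delta> (int d - 1) > 0"
      using F0 fin by (auto simp: f_entry_def face_dim_def card_gt_0_iff)
    then have "f_entry \<Delta>' (int d - 1) > 0"
      using formula[of d] veronese_coeff_diag_pos[OF assms(3), of d] by simp
    then have "{F \<in> \<Delta>'. face_dim F = int d - 1} \<noteq> {}"
      unfolding f_entry_def by (metis card.empty less_irrefl)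
    then show "int d - 1 \<in> face_dim ` \<Delta>'" by force
  qed
  moreover have "f_entry \<Delta>' (int i - 1) =
      (\<Sum>l=i..d. \<Sum>js | length js = i \<and> sum_list js = l \<and> (\<forall>j\<in>set js. j \<ge> 1).
         (case js of
            [] \<Rightarrow> 1
          | j # js' \<Rightarrow> ((r - 1) choose (j - 1)) * (\<Prod>j'\<leftarrow>js'. r choose j')) *
         f_entry \<Delta> (int l - 1))" for i
    unfolding formula[of i] veronese_coeff_def compositions_def subdivision_weight_def sum_distrib_right ..
  ultimately show ?thesis by blast
qed

end
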